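(* A CSP $A\subseteq T$ is unsatisfiable if and only if there is $d\in M^*$ such that for every $f\in\mathbb{R}^T$ with $A=A^*(f)$ there exists $\alpha>0$ such that $B(f+\alpha d)<B(f)$.
   Context: Fix a structure $(D,V,C)$: $V$ is a finite set of variables, $D$ a finite nonempty domain, $C\subseteq 2^V$ a set of non-empty subsets of $V$ (scopes). For $S\subseteq V$, $D^S$ is the set of maps $S\to D$; for an assignment $x\in D^V$, $x[S]\in D^S$ is its restriction to $S$. Tuples: $T_S=\{(S,k)\mid k\in D^S\}$ for $S\in C$ and $T=\bigcup_{S\in C}T_S$. A CSP is a subset $A\subseteq T$ (of allowed tuples); $x\in D^V$ is a solution of $A$ if $(S,x[S])\in A$ for all $S\in C$; $A$ is unsatisfiable if it has no solution. A WCSP is a vector $f\in\mathbb{R}^T$. The map $\phi\colon D^V\to\{0,1\}^T$ is defined by $\phi_{(S,k)}(x)=1$ if $x[S]=k$ and $0$ otherwise, so $\langle f,\phi(x)\rangle=\sum_{S\in C}f_{(S,x[S])}$. Let $M^*=\{d\in\mathbb{R}^T\mid \langle d,\phi(x)\rangle\ge 0\ \forall x\in D^V\}$. Upper bound: $B(f)=\sum_{S\in C}\max_{t\in T_S}f_t$. A tuple $t\in T_S$ is active for $f$ if $f_t=\max_{t'\in T_S}f_{t'}$; $A^*(f)\subseteq T$ is the set of all tuples active for $f$, viewed as a CSP. *)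

theory Defs
  imports Complex_Main "HOL-Library.FuncSet"
begin

text \<open>
  The set \<open>D\<^sup>S\<close> of maps from \<open>S\<close> to \<open>D\<close> is the extensional function space \<open>S \<rightarrow>\<^sub>E D\<close>, and the
  restriction \<open>x[S]\<close> is \<open>restrict x S\<close>.  Likewise a vector indexed by a set \<open>I\<close> of tuples is an
  element of \<open>I \<rightarrow>\<^sub>E UNIV\<close>; operations on such vectors are restricted to \<open>I\<close> so that they stay in
  that space.
\<close>

type_synonym ('v, 'd) tuple = "'v set \<times> ('v \<Rightarrow> 'd)"

definition csp_structure :: "'d set \<Rightarrow> 'v set \<Rightarrow> 'v set set \<Rightarrow> bool" where
  "csp_structure D V C \<longleftrightarrow>
     finite V \<and> finite D \<and> D \<noteq> {} \<and> C \<subseteq> Pow V \<and> (\<forall>S\<in>C. S \<noteq> {})"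

definition assignments :: "'d set \<Rightarrow> 'v set \<Rightarrow> ('v \<Rightarrow> 'd) set" where
  "assignments D S = S \<rightarrow>\<^sub>E D"

definition scope_tuples :: "'d set \<Rightarrow> 'v set \<Rightarrow> ('v, 'd) tuple set" where
  "scope_tuples D S = {(S, k) | k. k \<in> assignments D S}"

definition tuples :: "'d set \<Rightarrow> 'v set set \<Rightarrow> ('v, 'd) tuple set" where
  "tuples D C = (\<Union>S\<in>C. scope_tuples D S)"

definition csp_solution ::
  "'d set \<Rightarrow> 'v set \<Rightarrow> 'v set set \<Rightarrow> ('v, 'd) tuple set \<Rightarrow> ('v \<Rightarrow> 'd) \<Rightarrow> bool" where
  "csp_solution D V C A x \<longleftrightarrow> x \<in> assignments D V \<and> (\<forall>S\<in>C. (S, restrict x S) \<in> A)"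

definition unsatisfiable ::
  "'d set \<Rightarrow> 'v set \<Rightarrow> 'v set set \<Rightarrow> ('v, 'd) tuple set \<Rightarrow> bool" where
  "unsatisfiable D V C A \<longleftrightarrow> \<not> (\<exists>x. csp_solution D V C A x)"

definition wcsps :: "'d set \<Rightarrow> 'v set set \<Rightarrow> (('v, 'd) tuple \<Rightarrow> real) set" where
  "wcsps D C = tuples D C \<rightarrow>\<^sub>E UNIV"

definition wcsp_add_scaled ::
  "'d set \<Rightarrow> 'v set set \<Rightarrow> (('v, 'd) tuple \<Rightarrow> real) \<Rightarrow> real \<Rightarrow> (('v, 'd) tuple \<Rightarrow> real)
    \<Rightarrow> ('v, 'd) tuple \<Rightarrow> real" where
  "wcsp_add_scaled D C f \<alpha> d = (\<lambda>t\<in>tuples D C. f t + \<alpha> * d t)"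

definition wcsp_inner ::
  "'d set \<Rightarrow> 'v set set \<Rightarrow> (('v, 'd) tuple \<Rightarrow> real) \<Rightarrow> (('v, 'd) tuple \<Rightarrow> real) \<Rightarrow> real" where
  "wcsp_inner D C f g = (\<Sum>t\<in>tuples D C. f t * g t)"

definition phi :: "'d set \<Rightarrow> 'v set set \<Rightarrow> ('v \<Rightarrow> 'd) \<Rightarrow> ('v, 'd) tuple \<Rightarrow> real" where
  "phi D C x = (\<lambda>t\<in>tuples D C. case t of (S, k) \<Rightarrow> if restrict x S = k then 1 else 0)"

definition Mstar :: "'d set \<Rightarrow> 'v set \<Rightarrow> 'v set set \<Rightarrow> (('v, 'd) tuple \<Rightarrow> real) set" where
  "Mstar D V C = {d \<in> wcsps D C. \<forall>x\<in>assignments D V. wcsp_inner D C d (phi D C x) \<ge> 0}"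

definition upper_bound :: "'d set \<Rightarrow> 'v set set \<Rightarrow> (('v, 'd) tuple \<Rightarrow> real) \<Rightarrow> real" where
  "upper_bound D C f = (\<Sum>S\<in>C. Max (f ` scope_tuples D S))"

definition active_tuples ::
  "'d set \<Rightarrow> 'v set set \<Rightarrow> (('v, 'd) tuple \<Rightarrow> real) \<Rightarrow> ('v, 'd) tuple set" where
  "active_tuples D C f = (\<Union>S\<in>C. {t \<in> scope_tuples D S. f t = Max (f ` scope_tuples D S)})"

end

theory Submission
  imports Defs
begin

text \<open>
  A solution \<open>x\<close> of \<open>A = A\<^sup>*(f)\<close> attains \<open>B(f) = \<langle>f, \<phi>(x)\<rangle>\<close>, and no \<open>d \<in> M\<^sup>*\<close> decreases that
  inner product, which bounds \<open>B\<close> from below.  Conversely, if \<open>A\<close> is unsatisfiable, every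
  assignment uses a tuple outside \<open>A\<close>, so the vector equal to \<open>-1\<close> on \<open>A\<close> and to \<open>|C|\<close> off \<open>A\<close>
  lies in \<open>M\<^sup>*\<close>; a small step along it lowers all active tuples while the inactive ones remain
  below the old maximum.
\<close>

text \<open>Lets a sum over all tuples be split into a sum over scopes of sums over
  assignments.\<close>

lemma tuples_eq_Sigma: "tuples D C = Sigma C (assignments D)"
  by (auto simp: tuples_def scope_tuples_def)

lemma scope_tuples_eq_image: "scope_tuples D S = Pair S ` assignments D S"
  by (auto simp: scope_tuples_def)

lemma scope_tuples_subset_tuples: "S \<in> C \<Longrightarrow> scope_tuples D S \<subseteq> tuples D C"
  by (auto simp: tuples_def)

context
  fixes D :: "'d set" and V :: "'v set" and C :: "'v set set"
  assumes str: "csp_structure D V C"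
begin

lemma finite_scopes: "finite C"
  using str by (meson csp_structure_def finite_Pow_iff finite_subset)

lemma finite_assignments: "S \<subseteq> V \<Longrightarrow> finite (assignments D S)"
  using str by (auto simp: csp_structure_def assignments_def intro!: finite_PiE intro: finite_subset)

lemma scope_subset: "S \<in> C \<Longrightarrow> S \<subseteq> V"
  using str by (auto simp: csp_structure_def)

lemma finite_scope_tuples: "S \<in> C \<Longrightarrow> finite (scope_tuples D S)"
  by (simp add: scope_tuples_eq_image finite_assignments scope_subset)

lemma finite_tuples: "finite (tuples D C)"
  by (simp add: tuples_def finite_scopes finite_scope_tuples)

lemma assignments_nonempty: "assignments D S \<noteq> {}"
  using str by (auto simp: csp_structure_def assignments_def PiE_eq_empty_iff)

lemma scope_tuples_nonempty: "scope_tuples D S \<noteq> {}"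
  by (simp add: scope_tuples_eq_image assignments_nonempty)

lemma restrict_in_assignments:
  "x \<in> assignments D V \<Longrightarrow> S \<in> C \<Longrightarrow> restrict x S \<in> assignments D S"
  using scope_subset by (fastforce simp: assignments_def)

lemma restrict_in_scope_tuples:
  "x \<in> assignments D V \<Longrightarrow> S \<in> C \<Longrightarrow> (S, restrict x S) \<in> scope_tuples D S"
  by (simp add: scope_tuples_def restrict_in_assignments)

text \<open>In each scope exactly one tuple agrees with \<open>x\<close>, so every inner sum
  collapses to a single term.\<close>

lemma wcsp_inner_phi:
  assumes "x \<in> assignments D V"
  shows "wcsp_inner D C f (phi D C x) = (\<Sum>S\<in>C. f (S, restrict x S))"
proof -
  have "wcsp_inner D C f (phi D C x) =
      (\<Sum>(S, k)\<in>Sigma C (assignments D). if restrict x S = k then f (S, k) else 0)"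
    unfolding wcsp_inner_def tuples_eq_Sigma
    by (intro sum.cong) (auto simp: phi_def tuples_eq_Sigma)
  also have "\<dots> = (\<Sum>S\<in>C. \<Sum>k\<in>assignments D S. if restrict x S = k then f (S, k) else 0)"
    by (rule sum.Sigma [symmetric]) (simp_all add: finite_scopes finite_assignments scope_subset)
  also have "\<dots> = (\<Sum>S\<in>C. f (S, restrict x S))"
    using assms
    by (intro sum.cong) (simp_all add: restrict_in_assignments finite_assignments scope_subset)
  finally show ?thesis .
qed

lemma wcsp_inner_phi_le_upper_bound:
  assumes "x \<in> assignments D V"
  shows "wcsp_inner D C f (phi D C x) \<le> upper_bound D C f"
  unfolding wcsp_inner_phi[OF assms] upper_bound_def
  by (intro sum_mono Max_ge finite_imageI finite_scope_tuples imageI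
      restrict_in_scope_tuples assms)

lemma wcsp_inner_phi_eq_upper_bound:
  assumes "csp_solution D V C (active_tuples D C f) x"
  shows "wcsp_inner D C f (phi D C x) = upper_bound D C f"
proof -
  have "x \<in> assignments D V"
    and "\<And>S. S \<in> C \<Longrightarrow> f (S, restrict x S) = Max (f ` scope_tuples D S)"
    using assms by (auto simp: csp_solution_def active_tuples_def scope_tuples_def)
  then show ?thesis
    by (simp add: wcsp_inner_phi upper_bound_def)
qed

lemma wcsp_inner_add_scaled:
  "wcsp_inner D C (wcsp_add_scaled D C f \<alpha> d) g = wcsp_inner D C f g + \<alpha> * wcsp_inner D C d g"
  by (simp add: wcsp_inner_def wcsp_add_scaled_def algebra_simps sum.distrib sum_distrib_left)

lemma upper_bound_add_scaled_ge:
  assumes "csp_solution D V C (active_tuples D C f) x" "d \<in> Mstar D V C" "\<alpha> > 0"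
  shows "upper_bound D C f \<le> upper_bound D C (wcsp_add_scaled D C f \<alpha> d)"
proof -
  have x: "x \<in> assignments D V"
    using assms(1) by (simp add: csp_solution_def)
  have "upper_bound D C f = wcsp_inner D C f (phi D C x)"
    using wcsp_inner_phi_eq_upper_bound[OF assms(1)] by simp
  also have "\<dots> \<le> wcsp_inner D C (wcsp_add_scaled D C f \<alpha> d) (phi D C x)"
    using assms(2,3) x by (simp add: wcsp_inner_add_scaled Mstar_def)
  \<comment> \<open>The bound dominates the value at every assignment, whether or not
    \<open>x\<close> uses only active tuples after the step.\<close>
  also have "\<dots> \<le> upper_bound D C (wcsp_add_scaled D C f \<alpha> d)"
    by (rule wcsp_inner_phi_le_upper_bound[OF x])
  finally show ?thesis .
qed

text \<open>Supplies a vector whose active set is a prescribed \<open>A\<close>. By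
  \<open>meets\<close>, the maximum in every scope is 1; a scope missed by \<open>A\<close> would
  have maximum 0 and all its tuples active.\<close>

lemma active_tuples_indicator:
  assumes "A \<subseteq> tuples D C" and meets: "\<And>S. S \<in> C \<Longrightarrow> A \<inter> scope_tuples D S \<noteq> {}"
  shows "active_tuples D C (\<lambda>t\<in>tuples D C. if t \<in> A then 1 else 0) = A"
proof -
  let ?f = "\<lambda>t\<in>tuples D C. if t \<in> A then 1 else 0 :: real"
  have "Max (?f ` scope_tuples D S) = 1" if S: "S \<in> C" for S
  proof (rule Max_eqI)
    show "finite (?f ` scope_tuples D S)"
      by (simp add: finite_scope_tuples S)
    show "y \<le> 1" if "y \<in> ?f ` scope_tuples D S" for y
      using that scope_tuples_subset_tuples[OF S] by auto
    obtain t where "t \<in> A" "t \<in> scope_tuples D S"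
      using meets[OF S] by blast
    then show "1 \<in> ?f ` scope_tuples D S"
      using assms(1) by (auto intro!: image_eqI[of _ _ t])
  qed
  then have "active_tuples D C ?f = (\<Union>S\<in>C. {t \<in> scope_tuples D S. t \<in> A})"
    using scope_tuples_subset_tuples
    by (fastforce simp: active_tuples_def split: if_splits)
  also have "\<dots> = A"
    using assms(1) by (auto simp: tuples_def)
  finally show ?thesis .
qed

lemma unsat_direction_in_Mstar:
  assumes "unsatisfiable D V C A"
  shows "(\<lambda>t\<in>tuples D C. if t \<in> A then -1 else real (card C)) \<in> Mstar D V C"
    (is "?d \<in> _")
proof -
  have "0 \<le> wcsp_inner D C ?d (phi D C x)" if x: "x \<in> assignments D V" for x
  proof -
    let ?e = "\<lambda>S. if (S, restrict x S) \<in> A then -1 else real (card C)"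
    obtain S0 where S0: "S0 \<in> C" "(S0, restrict x S0) \<notin> A"
      using assms x by (auto simp: unsatisfiable_def csp_solution_def)
    \<comment> \<open>The weight \<open>card C\<close> earned at \<open>S0\<close> outweighs the
      other scopes, which lose at most 1 each.\<close>
    have "(\<Sum>S\<in>C - {S0}. -1) \<le> (\<Sum>S\<in>C - {S0}. ?e S)"
      by (intro sum_mono) simp
    moreover have "real (card (C - {S0})) \<le> real (card C)"
      using finite_scopes by (simp add: card_mono)
    ultimately have "0 \<le> ?e S0 + (\<Sum>S\<in>C - {S0}. ?e S)"
      using S0(2) by simp
    also have "\<dots> = (\<Sum>S\<in>C. ?e S)"
      using sum.remove[OF finite_scopes S0(1), of ?e] by simp
    also have "\<dots> = wcsp_inner D C ?d (phi D C x)"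
      unfolding wcsp_inner_phi[OF x]
      by (intro sum.cong) (simp_all add: tuples_eq_Sigma restrict_in_assignments x)
    finally show ?thesis .
  qed
  then show ?thesis
    by (simp add: Mstar_def wcsps_def)
qed

text \<open>For small \<alpha> every tuple falls strictly below the old maximum of its scope, so
  each summand of the bound drops. Some scope must exist: for empty \<open>C\<close> both bounds are
  0.\<close>

lemma upper_bound_add_scaled_less:
  assumes "C \<noteq> {}" and neg: "\<And>t. t \<in> active_tuples D C f \<Longrightarrow> d t < 0"
  shows "\<exists>\<alpha>>0. upper_bound D C (wcsp_add_scaled D C f \<alpha> d) < upper_bound D C f"
proof -
  define m where "m S = Max (f ` scope_tuples D S)" for S
  \<comment> \<open>The filter \<open>at_right 0\<close> expresses "for all small enough positive
    \<alpha>"; finitely many such conditions hold jointly, so no explicit step size is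
    computed.\<close>
  have "\<forall>\<^sub>F \<alpha> in at_right 0. f t + \<alpha> * d t < m (fst t)" if t: "t \<in> tuples D C" for t
  proof -
    obtain S where S: "S \<in> C" "t \<in> scope_tuples D S" "fst t = S"
      using t by (auto simp: tuples_def scope_tuples_def)
    have le: "f t \<le> m S"
      unfolding m_def using S by (intro Max_ge) (auto simp: finite_scope_tuples)
    show ?thesis
    proof (cases "f t = m S")
      case True
      \<comment> \<open>An active tuple drops below the maximum for every positive \<alpha>.\<close>
      then have "d t < 0"
        using S by (intro neg) (auto simp: active_tuples_def m_def)
      then show ?thesis
        using True S(3)
        by (intro eventually_mono[OF eventually_at_right_less]) (simp add: mult_pos_neg)
    next
      case False
      \<comment> \<open>An inactive tuple has a strict gap to the maximum, which survives small
        \<alpha> by continuity.\<close>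
      have "((\<lambda>\<alpha>. f t + \<alpha> * d t) \<longlongrightarrow> f t + 0 * d t) (at_right 0)"
        by (intro tendsto_intros)
      then show ?thesis
        using False le S(3) by (intro order_tendstoD(2)) auto
    qed
  qed
  then have "\<forall>\<^sub>F \<alpha> in at_right 0. \<forall>t\<in>tuples D C. f t + \<alpha> * d t < m (fst t)"
    by (intro eventually_ball_finite finite_tuples) blast
  then have "\<forall>\<^sub>F \<alpha> in at_right 0. 0 < \<alpha> \<and> (\<forall>t\<in>tuples D C. f t + \<alpha> * d t < m (fst t))"
    using eventually_at_right_less by (rule eventually_conj[rotated])
  then obtain \<alpha> where \<alpha>: "\<alpha> > 0" "\<And>t. t \<in> tuples D C \<Longrightarrow> f t + \<alpha> * d t < m (fst t)"
    using eventually_happens'[OF trivial_limit_at_right_real] by blast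
  have "Max (wcsp_add_scaled D C f \<alpha> d ` scope_tuples D S) < m S" if S: "S \<in> C" for S
  proof -
    have "wcsp_add_scaled D C f \<alpha> d t < m S" if "t \<in> scope_tuples D S" for t
      using that \<alpha>(2)[of t] scope_tuples_subset_tuples[OF S]
      by (auto simp: wcsp_add_scaled_def scope_tuples_def)
    then show ?thesis
      by (simp add: finite_scope_tuples[OF S] scope_tuples_nonempty)
  qed
  then have "upper_bound D C (wcsp_add_scaled D C f \<alpha> d) < upper_bound D C f"
    unfolding upper_bound_def m_def
    by (intro sum_strict_mono finite_scopes \<open>C \<noteq> {}\<close>)
  with \<alpha>(1) show ?thesis
    by blast
qed

end

theorem corollary1:
  fixes D :: "'d set" and V :: "'v set" and C :: "'v set set"
    and A :: "('v, 'd) tuple set"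
  assumes "csp_structure D V C"
    and "A \<subseteq> tuples D C"
  shows "unsatisfiable D V C A \<longleftrightarrow>
    (\<exists>d\<in>Mstar D V C. \<forall>f\<in>wcsps D C. A = active_tuples D C f \<longrightarrow>
       (\<exists>\<alpha>>0. upper_bound D C (wcsp_add_scaled D C f \<alpha> d) < upper_bound D C f))"
    (is "_ \<longleftrightarrow> ?R")
proof
  assume unsat: "unsatisfiable D V C A"
  \<comment> \<open>Without scopes, any assignment would vacuously be a solution, and one exists
    because \<open>D\<close> is nonempty.\<close>
  then have "C \<noteq> {}"
    using assignments_nonempty[OF assms(1), of V]
    by (auto simp: unsatisfiable_def csp_solution_def)
  \<comment> \<open>The direction is built from \<open>A\<close> alone, so one \<open>d\<close>
    serves all \<open>f\<close> with active set \<open>A\<close>.\<close>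
  then show ?R
    using assms(2)
    by (intro bexI[OF _ unsat_direction_in_Mstar[OF assms(1) unsat]] ballI impI
        upper_bound_add_scaled_less[OF assms(1)]) auto
next
  assume ?R
  then obtain d where d: "d \<in> Mstar D V C"
    and dec: "\<And>f. f \<in> wcsps D C \<Longrightarrow> A = active_tuples D C f \<Longrightarrow>
      \<exists>\<alpha>>0. upper_bound D C (wcsp_add_scaled D C f \<alpha> d) < upper_bound D C f"
    by blast
  show "unsatisfiable D V C A"
    unfolding unsatisfiable_def
  proof
    assume "\<exists>x. csp_solution D V C A x"
    then obtain x where x: "csp_solution D V C A x" ..
    \<comment> \<open>The assumption on \<open>d\<close> speaks only of vectors with active set
      \<open>A\<close>, so one must be exhibited. The indicator of \<open>A\<close> works, since the
      solution \<open>x\<close> puts a tuple of \<open>A\<close> in every scope.\<close>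
    define f :: "('v, 'd) tuple \<Rightarrow> real" where "f = (\<lambda>t\<in>tuples D C. if t \<in> A then 1 else 0)"
    have f: "f \<in> wcsps D C"
      by (simp add: f_def wcsps_def)
    have "A \<inter> scope_tuples D S \<noteq> {}" if "S \<in> C" for S
      using x restrict_in_scope_tuples[OF assms(1) _ that] that by (auto simp: csp_solution_def)
    then have A: "A = active_tuples D C f"
      unfolding f_def by (simp add: active_tuples_indicator[OF assms])
    then obtain \<alpha> where "\<alpha> > 0"
      and "upper_bound D C (wcsp_add_scaled D C f \<alpha> d) < upper_bound D C f"
      using dec[OF f A] by blast
    moreover have "csp_solution D V C (active_tuples D C f) x"
      using x by (subst (asm) A)
    ultimately show False
      using upper_bound_add_scaled_ge[OF assms(1) _ d] by (meson not_le)
  qed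
qed

end
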